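(* Let $a\in\mathbb{R}$ and $\alpha \in (0,1]$. If $f\colon[a,\infty) \to \mathbb{R}$ is $\alpha$-differentiable at $t_0 \in [a,\infty)$, then $f$ is continuous at $t_0$ (as a function on $[a,\infty)$, so right continuous when $t_0=a$).
   Context: Let $a\in\mathbb{R}$ (the lower terminal) and $f\colon[a,\infty)\to\mathbb{R}$. The conformable derivative $T_a^\alpha f$ of order $\alpha\in(0,1]$ is defined as follows. (1) For $t\in(a,\infty)$: $T^{\alpha}_a f(t) = \lim_{\theta \to 0}\frac{f(t+\theta(t-a)^{1-\alpha}) - f(t)}{\theta}$, if the (finite) limit exists. (2) At $t=a$: $T_a^\alpha f(a)$ exists if and only if the right first derivative $f'(a)$ of $f$ at $a$ exists, and then $T_a^1 f(a)=f'(a)$, while $T_a^\alpha f(a)=0$ for $\alpha\in(0,1)$. $f$ is called $\alpha$-differentiable at a point if $T_a^\alpha f$ exists at that point. *)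

theory Defs
  imports "HOL-Analysis.Analysis"
begin

text \<open>
  A function on \<open>[a, \<infinity>)\<close> is given by a total function of which only the values on \<open>{a..}\<close> matter:
  for \<open>t > a\<close> the point \<open>t + \<theta> * (t - a) powr (1 - \<alpha>)\<close> lies in \<open>{a..}\<close> for all \<open>\<theta>\<close> close to 0,
  and at \<open>t = a\<close> the derivative is taken within \<open>{a..}\<close>, so it is the right derivative.
  The definitions are meant for \<open>0 < \<alpha> \<le> 1\<close>.
\<close>

definition has_conformable_derivative ::
    "real \<Rightarrow> real \<Rightarrow> (real \<Rightarrow> real) \<Rightarrow> real \<Rightarrow> real \<Rightarrow> bool" where
  "has_conformable_derivative a \<alpha> f t D \<longleftrightarrow>
     (t > a \<and> ((\<lambda>\<theta>. (f (t + \<theta> * (t - a) powr (1 - \<alpha>)) - f t) / \<theta>) \<longlongrightarrow> D) (at 0)) \<or>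
     (t = a \<and> (\<exists>D'. (f has_real_derivative D') (at a within {a..}) \<and>
                    D = (if \<alpha> = 1 then D' else 0)))"

definition conformable_differentiable ::
    "real \<Rightarrow> real \<Rightarrow> (real \<Rightarrow> real) \<Rightarrow> real \<Rightarrow> bool" where
  "conformable_differentiable a \<alpha> f t \<longleftrightarrow> (\<exists>D. has_conformable_derivative a \<alpha> f t D)"

end

theory Submission
  imports Defs
begin

text \<open>For fixed t > a the factor (t - a)^(1 - \<alpha>) is a positive constant, so the
  conformable quotient is the ordinary difference quotient up to a linear change of the increment.
  Hence f is differentiable at t in the usual sense, and so continuous. At a, a right derivative is
  part of the definition for every \<alpha>.\<close>

lemma has_conformable_derivative_imp_has_real_derivative:
  assumes "has_conformable_derivative a \<alpha> f t D" and "t > a"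
  shows "(f has_real_derivative D / (t - a) powr (1 - \<alpha>)) (at t)"
proof -
  define c where "c = (t - a) powr (1 - \<alpha>)"
  have c: "c > 0"
    using \<open>t > a\<close> by (simp add: c_def)
  have lim: "((\<lambda>\<theta>. (f (t + \<theta> * c) - f t) / \<theta>) \<longlongrightarrow> D) (at 0)"
    using assms by (simp add: has_conformable_derivative_def c_def)
  \<comment> \<open>Substitute \<theta> = h / c. As \<open>lim\<close> is a punctured limit, h / c
    must tend to 0 without taking the value 0.\<close>
  have "((\<lambda>h. h / c) \<longlongrightarrow> 0 / c) (at 0)"
    using c by (intro tendsto_intros) auto
  moreover have "\<forall>\<^sub>F h in at 0. h / c \<noteq> 0"
    using c by (simp add: eventually_at_filter)
  ultimately have "filterlim (\<lambda>h. h / c) (at 0) (at 0)"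
    by (simp add: filterlim_at)
  \<comment> \<open>The substituted quotient has denominator h / c; dividing it by c leaves the
    denominator h.\<close>
  from tendsto_divide[OF filterlim_compose[OF lim this] tendsto_const[of c]] c
  have "((\<lambda>h. (f (t + h) - f t) / h) \<longlongrightarrow> D / c) (at 0)"
    by simp
  then show ?thesis
    by (simp add: DERIV_def c_def)
qed

theorem theorem5p1:
  fixes a \<alpha> t\<^sub>0 :: real and f :: "real \<Rightarrow> real"
  assumes "0 < \<alpha>" and "\<alpha> \<le> 1"
    and "t\<^sub>0 \<in> {a..}"
    and "conformable_differentiable a \<alpha> f t\<^sub>0"
  shows "continuous (at t\<^sub>0 within {a..}) f"
proof -
  obtain D where D: "has_conformable_derivative a \<alpha> f t\<^sub>0 D"
    using assms(4) by (auto simp: conformable_differentiable_def)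
  show ?thesis
  proof (cases "t\<^sub>0 = a")
    case True
    then show ?thesis
      using D by (auto simp: has_conformable_derivative_def intro: DERIV_continuous)
  next
    case False
    then have "t\<^sub>0 > a"
      using assms(3) by simp
    \<comment> \<open>Two-sided continuity at an interior point restricts to
      \<open>{a..}\<close>.\<close>
    from has_conformable_derivative_imp_has_real_derivative[OF D this] show ?thesis
      by (rule continuous_at_imp_continuous_at_within[OF DERIV_isCont])
  qed
qed

end
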